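(* The misère suspense number $S^-$ of paths is non-decreasing in $n$, and for every $n\ge 0$: 1. $S^-(P_{7\cdot 2^n-6})=2n+1$; 2. $S^-(P_{7\cdot 2^n-5})=2n+1$; 3. $S^-(P_k)=2n+2$ for every $k$ with $7\cdot 2^n-4\le k\le 7\cdot 2^{n+1}-7$.
   Context: For $n\ge 0$, $P_n$ denotes the path on $n$ vertices ($P_0$ is the empty graph). A Node-Kayles move on a path $P_k$ with $k\ge 1$ chooses a vertex and deletes it together with its neighbours. The possible results are: $P_0$ if $k\in\{1,2\}$; $P_0$ or $P_1$ if $k=3$; and, for $k\ge 4$, $P_{k-2}$, $P_{k-3}$, or two paths $P_i,P_j$ with $j\ge i\ge1$, $i+j=k-3$. In the continued conjunctive compound game, a position $G$ is a finite multiset of paths (components). A move replaces every nonempty component simultaneously by the result of a Node-Kayles move on it; a split component yields two components. The set $O(G)$ of options of $G$ consists of all positions obtainable by one such move, and $O(G)=\emptyset$ exactly when all components are empty. The misère suspense number $S^-$ is defined recursively as follows: - $S^-(G)=0$ if $O(G)=\emptyset$; - $S^-(G)=1+\max\{S^-(G'):G'\in O(G),\ S^-(G')\text{ odd}\}$ if some option has odd suspense number; - $S^-(G)=1+\min\{S^-(G'):G'\in O(G)\}$ otherwise, in which case all these values are even. $S^-(P_n)$ denotes the suspense number of the single component $P_n$. *)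

theory Defs
  imports "HOL-Library.Multiset"
begin

text \<open>A path is represented by its number of vertices, and a position by the multiset of its
  components. Empty components (entries \<open>0\<close>) are allowed.\<close>

type_synonym position = "nat multiset"

definition node_kayles_results :: "nat \<Rightarrow> position set" where
  "node_kayles_results k =
    (if k = 0 then {}
     else if k \<le> 2 then {{#0#}}
     else if k = 3 then {{#0#}, {#1#}}
     else {{#k - 2#}, {#k - 3#}} \<union> {{#i, j#} | i j. 1 \<le> i \<and> i \<le> j \<and> i + j = k - 3})"

text \<open>Empty components stay in place during a move.\<close>

definition component_results :: "nat \<Rightarrow> position set" where
  "component_results k = (if k = 0 then {{#0#}} else node_kayles_results k)"

text \<open>The multiset \<open>R\<close> records one result for each component (with multiplicity), so that equal
  components may be replaced differently. The guard is needed because otherwise a position all of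
  whose components are empty would be an option of itself.\<close>

definition options :: "position \<Rightarrow> position set" where
  "options G =
    (if \<exists>k\<in>#G. k \<noteq> 0
     then {\<Sum>\<^sub># R | R. rel_mset (\<lambda>k N. N \<in> component_results k) G R}
     else {})"

lemma node_kayles_results_sum_less: "N \<in> node_kayles_results k \<Longrightarrow> sum_mset N < k"
  by (auto simp: node_kayles_results_def split: if_splits)

lemma finite_component_results: "finite (component_results k)"
proof -
  have "{{#i, j#} | i j. 1 \<le> i \<and> i \<le> j \<and> i + j = k - 3}
      \<subseteq> (\<lambda>(i, j). {#i, j#}) ` ({..k} \<times> {..k})"
    by force
  then have "finite {{#i, j#} | i j. 1 \<le> i \<and> i \<le> j \<and> i + j = k - 3}"
    by (rule finite_subset) simp
  then show ?thesis
    by (simp add: component_results_def node_kayles_results_def)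
qed

lemma rel_mset_component_results_sum:
  assumes "rel_mset (\<lambda>k N. N \<in> component_results k) G R"
  shows "sum_mset (\<Sum>\<^sub># R) \<le> sum_mset G"
    and "\<exists>k\<in>#G. k \<noteq> 0 \<Longrightarrow> sum_mset (\<Sum>\<^sub># R) < sum_mset G"
proof -
  have "sum_mset (\<Sum>\<^sub># R) \<le> sum_mset G \<and>
      ((\<exists>k\<in>#G. k \<noteq> 0) \<longrightarrow> sum_mset (\<Sum>\<^sub># R) < sum_mset G)"
    using assms
  proof (induction G arbitrary: R)
    case empty
    then show ?case by (simp add: rel_mset_def)
  next
    case (add k G)
    then obtain N R' where R: "R = add_mset N R'" "N \<in> component_results k"
        "rel_mset (\<lambda>k N. N \<in> component_results k) G R'"
      by (blast dest: msed_rel_invL)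
    then show ?case
      using add.IH[OF R(3)] node_kayles_results_sum_less[of N k]
      by (cases "k = 0") (auto simp: component_results_def)
  qed
  then show "sum_mset (\<Sum>\<^sub># R) \<le> sum_mset G"
    and "\<exists>k\<in>#G. k \<noteq> 0 \<Longrightarrow> sum_mset (\<Sum>\<^sub># R) < sum_mset G"
    by auto
qed

lemma options_sum_less: "G' \<in> options G \<Longrightarrow> sum_mset G' < sum_mset G"
  unfolding options_def by (auto split: if_splits intro!: rel_mset_component_results_sum(2))

lemma options_finite: "finite (options G)"
proof -
  have "finite {R. rel_mset (\<lambda>k N. N \<in> component_results k) G R}"
  proof (induction G)
    case empty
    have "{R. rel_mset (\<lambda>k N. N \<in> component_results k) {#} R} \<subseteq> {{#}}"
      by (auto simp: rel_mset_def)
    then show ?case by (rule finite_subset) simp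
  next
    case (add k G)
    have "{R. rel_mset (\<lambda>k N. N \<in> component_results k) (add_mset k G) R}
        \<subseteq> (\<lambda>(N, R). add_mset N R) `
          (component_results k \<times> {R. rel_mset (\<lambda>k N. N \<in> component_results k) G R})"
      by (fastforce dest: msed_rel_invL)
    then show ?case
      by (rule finite_subset) (use add finite_component_results in auto)
  qed
  then have "finite (sum_mset ` {R. rel_mset (\<lambda>k N. N \<in> component_results k) G R})"
    by simp
  moreover have "options G \<subseteq> sum_mset ` {R. rel_mset (\<lambda>k N. N \<in> component_results k) G R}"
    by (auto simp: options_def)
  ultimately show ?thesis
    by (rule rev_finite_subset)
qed

lemma options_eq_empty_iff: "options G = {} \<longleftrightarrow> (\<forall>k\<in>#G. k = 0)"
proof -
  have "\<exists>N. N \<in> component_results k" for k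
    by (auto simp: component_results_def node_kayles_results_def)
  then obtain f where f: "\<And>k. f k \<in> component_results k"
    by metis
  have "rel_mset (\<lambda>k N. N \<in> component_results k) G (image_mset f G)"
    by (induction G) (auto simp: rel_mset_Zero f intro: rel_mset_Plus)
  then show ?thesis
    by (auto simp: options_def)
qed

text \<open>\<open>Max\<close> and \<open>Min\<close> are taken over nonempty sets, which are finite by the lemma options_finite.\<close>

function misere_suspense :: "position \<Rightarrow> nat" where
  "misere_suspense G =
    (if options G = {} then 0
     else if \<exists>s \<in> misere_suspense ` options G. odd s
     then 1 + Max {s \<in> misere_suspense ` options G. odd s}
     else 1 + Min (misere_suspense ` options G))"
  by auto
termination
  by (relation "measure sum_mset") (auto simp: options_sum_less)

declare misere_suspense.simps [simp del]

end

theory Submission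
  imports Defs
begin

text \<open>The suspense number of a position is the maximum of those of its components, so the options of
  a path \<open>P\<^sub>k\<close> have the suspense numbers of the paths \<open>P\<^sub>j\<close> with \<open>(k - 2) div 2 \<le> j \<le> k - 2\<close>, as
  long as these are non-decreasing in \<open>j\<close>. Let \<open>a = 7 * 2 ^ n - 6\<close>. If the window of \<open>a\<close> has constant
  value \<open>2 * n\<close>, then \<open>a\<close> and \<open>a + 1\<close> get the value \<open>2 * n + 1\<close>. The windows of \<open>a + 2, \<dots>, 2 * a + 5\<close>
  all meet \<open>{a, a + 1}\<close>, which gives the value \<open>2 * n + 2\<close>, and the window of \<open>2 * a + 6\<close> is the
  first to start beyond \<open>a + 1\<close>.\<close>

section \<open>The defining recursion as a relation between option values and result\<close>

text \<open>\<open>V\<close> stands for the set of option values. The parity of \<open>m\<close>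
  encodes the branch of the recursion, since \<open>m - 1\<close> is itself an option value: the
  largest odd one if \<open>m\<close> is even, the minimum if \<open>m\<close> is odd.
  \<open>0 < m\<close> keeps the subtraction honest.\<close>

definition is_suspense :: "nat set \<Rightarrow> nat \<Rightarrow> bool" where
  "is_suspense V m \<longleftrightarrow> 0 < m \<and> m - 1 \<in> V \<and>
    (if odd m then \<forall>v\<in>V. even v \<and> m - 1 \<le> v else \<forall>v\<in>V. odd v \<longrightarrow> v < m)"

text \<open>For equal parities, each of \<open>m - 1\<close> and \<open>m' - 1\<close> lies in
  \<open>V\<close> and is bounded through the other. For different parities, the odd one forces
  \<open>V\<close> to be even, but the even one puts an odd element into \<open>V\<close>.\<close>

lemma is_suspense_unique:
  assumes "is_suspense V m" "is_suspense V m'"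
  shows "m = m'"
proof -
  have "0 < m" "0 < m'" and mem: "m - 1 \<in> V" "m' - 1 \<in> V"
    using assms by (simp_all add: is_suspense_def)
  have odd: "even v \<and> l - 1 \<le> v" if "is_suspense V l" "odd l" "v \<in> V" for l v
    using that by (simp add: is_suspense_def)
  have even: "v < l" if "is_suspense V l" "even l" "v \<in> V" "odd v" for l v
    using that by (simp add: is_suspense_def)
  show ?thesis
  proof (cases "odd m"; cases "odd m'")
    assume "odd m" "odd m'"
    then have "m - 1 \<le> m' - 1" "m' - 1 \<le> m - 1"
      using odd assms mem by blast+
    then show ?thesis
      using \<open>0 < m\<close> \<open>0 < m'\<close> by linarith
  next
    assume "odd m" "\<not> odd m'"
    then show ?thesis
      using odd[OF assms(1) _ mem(2)] \<open>0 < m'\<close> by simp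
  next
    assume "\<not> odd m" "odd m'"
    then show ?thesis
      using odd[OF assms(2) _ mem(1)] \<open>0 < m\<close> by simp
  next
    assume "\<not> odd m" "\<not> odd m'"
    then have "m - 1 < m'" "m' - 1 < m"
      using even[OF assms(1) _ mem(2)] even[OF assms(2) _ mem(1)] \<open>0 < m\<close> \<open>0 < m'\<close> by simp_all
    then show ?thesis
      by linarith
  qed
qed

lemma is_suspense_misere_suspense:
  assumes "options G \<noteq> {}"
  shows "is_suspense (misere_suspense ` options G) (misere_suspense G)"
proof -
  let ?V = "misere_suspense ` options G"
  have fin: "finite ?V" "?V \<noteq> {}"
    using assms options_finite by auto
  show ?thesis
  proof (cases "\<exists>s\<in>?V. odd s")
    case True
    let ?O = "{s \<in> ?V. odd s}"
    have O: "finite ?O" "?O \<noteq> {}"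
      using fin True by auto
    have eq: "misere_suspense G = 1 + Max ?O"
      using True assms misere_suspense.simps[of G] by simp
    have "Max ?O \<in> ?O" "\<forall>v\<in>?O. v \<le> Max ?O"
      using Max_in[OF O] Max_ge[OF O(1)] by blast+
    then show ?thesis
      unfolding is_suspense_def eq by (auto simp: less_Suc_eq_le)
  next
    case False
    have eq: "misere_suspense G = 1 + Min ?V"
      using False assms misere_suspense.simps[of G] by simp
    have "Min ?V \<in> ?V" "\<forall>v\<in>?V. Min ?V \<le> v"
      using Min_in[OF fin] Min_le[OF fin(1)] by blast+
    then show ?thesis
      using False unfolding is_suspense_def eq by auto
  qed
qed

lemma misere_suspense_eqI:
  assumes "is_suspense (misere_suspense ` options G) m"
  shows "misere_suspense G = m"
proof -
  have "options G \<noteq> {}"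
    using assms by (auto simp: is_suspense_def)
  then show ?thesis
    using assms is_suspense_misere_suspense is_suspense_unique by blast
qed

lemma misere_suspense_terminal: "\<forall>k\<in>#G. k = 0 \<Longrightarrow> misere_suspense G = 0"
  using options_eq_empty_iff[of G] misere_suspense.simps[of G] by simp

section \<open>Moves on sums and the maximum rule\<close>

text \<open>Unlike \<open>options\<close>, this lets a terminal position stay as it is, which is what happens to it as a
  part of a sum.\<close>

definition moves :: "position \<Rightarrow> position set" where
  "moves G = {\<Sum>\<^sub># R | R. rel_mset (\<lambda>k N. N \<in> component_results k) G R}"

lemma moves_empty: "moves {#} = {{#}}"
  by (auto simp: moves_def rel_mset_def)

lemma moves_add_mset:
  "moves (add_mset k G) = {N + B | N B. N \<in> component_results k \<and> B \<in> moves G}"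
proof (intro set_eqI iffI)
  fix X assume "X \<in> moves (add_mset k G)"
  then show "X \<in> {N + B | N B. N \<in> component_results k \<and> B \<in> moves G}"
    by (force simp: moves_def dest!: msed_rel_invL)
next
  fix X assume "X \<in> {N + B | N B. N \<in> component_results k \<and> B \<in> moves G}"
  then obtain N R where "X = \<Sum>\<^sub># (add_mset N R)" "N \<in> component_results k"
      "rel_mset (\<lambda>k N. N \<in> component_results k) G R"
    by (auto simp: moves_def)
  then show "X \<in> moves (add_mset k G)"
    unfolding moves_def by (blast intro: rel_mset_Plus)
qed

lemma moves_plus: "moves (G + H) = {A + B | A B. A \<in> moves G \<and> B \<in> moves H}"
proof (induction G)
  case empty
  then show ?case by (simp add: moves_empty)
next
  case (add k G)
  have "X \<in> moves (add_mset k G + H) \<longleftrightarrow>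
      (\<exists>N A B. X = N + A + B \<and> N \<in> component_results k \<and> A \<in> moves G \<and> B \<in> moves H)" for X
    using add by (force simp: moves_add_mset add.assoc)
  moreover have "X \<in> {A + B | A B. A \<in> moves (add_mset k G) \<and> B \<in> moves H} \<longleftrightarrow>
      (\<exists>N A B. X = N + A + B \<and> N \<in> component_results k \<and> A \<in> moves G \<and> B \<in> moves H)" for X
    unfolding moves_add_mset by blast
  ultimately show ?case
    by blast
qed

lemma moves_nonterminal: "\<exists>k\<in>#G. k \<noteq> 0 \<Longrightarrow> moves G = options G"
  by (auto simp: moves_def options_def)

lemma moves_terminal: "\<forall>k\<in>#G. k = 0 \<Longrightarrow> moves G = {G}"
  by (induction G) (auto simp: moves_empty moves_add_mset component_results_def)

lemma options_singleton:
  assumes "0 < k"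
  shows "options {#k#} = node_kayles_results k"
  using assms moves_nonterminal[of "{#k#}"]
  by (auto simp: moves_add_mset moves_empty component_results_def)

text \<open>Makes terminal positions uniform with the others: a terminal \<open>G\<close> has value
  0 and moves only to itself, and \<open>0 - 1 = 0\<close> in \<open>nat\<close>. Only positivity
  separates the two cases.\<close>

lemma misere_suspense_moves:
  shows "\<exists>A\<in>moves G. misere_suspense A = misere_suspense G - 1"
    and "A \<in> moves G \<Longrightarrow> odd (misere_suspense G) \<Longrightarrow>
      even (misere_suspense A) \<and> misere_suspense G - 1 \<le> misere_suspense A"
    and "A \<in> moves G \<Longrightarrow> even (misere_suspense G) \<Longrightarrow> odd (misere_suspense A) \<Longrightarrow>
      misere_suspense A < misere_suspense G"
    and "\<exists>k\<in>#G. k \<noteq> 0 \<Longrightarrow> 0 < misere_suspense G"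
proof -
  let ?S = misere_suspense
  have "(\<exists>A\<in>moves G. ?S A = ?S G - 1) \<and>
    (\<forall>A\<in>moves G. (odd (?S G) \<longrightarrow> even (?S A) \<and> ?S G - 1 \<le> ?S A) \<and>
      (even (?S G) \<longrightarrow> odd (?S A) \<longrightarrow> ?S A < ?S G)) \<and>
    ((\<exists>k\<in>#G. k \<noteq> 0) \<longrightarrow> 0 < ?S G)"
  proof (cases "\<forall>k\<in>#G. k = 0")
    case True
    then show ?thesis
      by (simp add: moves_terminal misere_suspense_terminal)
  next
    case False
    then have "is_suspense (?S ` moves G) (?S G)"
      using is_suspense_misere_suspense[of G] options_eq_empty_iff[of G] moves_nonterminal[of G]
      by auto
    then show ?thesis
      unfolding is_suspense_def by (auto split: if_splits)
  qed
  then show "\<exists>A\<in>moves G. ?S A = ?S G - 1"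
    and "A \<in> moves G \<Longrightarrow> odd (?S G) \<Longrightarrow> even (?S A) \<and> ?S G - 1 \<le> ?S A"
    and "A \<in> moves G \<Longrightarrow> even (?S G) \<Longrightarrow> odd (?S A) \<Longrightarrow> ?S A < ?S G"
    and "\<exists>k\<in>#G. k \<noteq> 0 \<Longrightarrow> 0 < ?S G"
    by blast+
qed

text \<open>Pairing the two witnesses attains \<open>max a b - 1\<close>. Let \<open>a\<close> be
  the maximum. If \<open>a\<close> is odd, every \<open>S x\<close> is even and at least
  \<open>a - 1\<close>; an odd \<open>S y\<close> requires \<open>b\<close> even, so it is below
  \<open>b \<le> a - 1\<close> and cannot be the maximum. If \<open>a\<close> is even, any odd
  \<open>S x\<close> or \<open>S y\<close> is below \<open>a\<close>.\<close>

lemma is_suspense_max: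
  fixes S :: "'a \<Rightarrow> nat"
  assumes X: "\<exists>x\<in>X. S x = a - 1" "\<And>x. x \<in> X \<Longrightarrow> odd a \<Longrightarrow> even (S x) \<and> a - 1 \<le> S x"
      "\<And>x. x \<in> X \<Longrightarrow> even a \<Longrightarrow> odd (S x) \<Longrightarrow> S x < a"
    and Y: "\<exists>y\<in>Y. S y = b - 1" "\<And>y. y \<in> Y \<Longrightarrow> odd b \<Longrightarrow> even (S y) \<and> b - 1 \<le> S y"
      "\<And>y. y \<in> Y \<Longrightarrow> even b \<Longrightarrow> odd (S y) \<Longrightarrow> S y < b"
    and "0 < max a b"
  shows "is_suspense {max (S x) (S y) | x y. x \<in> X \<and> y \<in> Y} (max a b)"
proof -
  obtain x y where "x \<in> X" "y \<in> Y" "S x = a - 1" "S y = b - 1"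
    using X(1) Y(1) by blast
  then have 1: "max a b - 1 \<in> {max (S x) (S y) | x y. x \<in> X \<and> y \<in> Y}"
    by (intro CollectI exI[of _ x] exI[of _ y]) auto
  have 2: "even (max (S x) (S y)) \<and> max a b - 1 \<le> max (S x) (S y)"
    if "odd (max a b)" "x \<in> X" "y \<in> Y" for x y
    using that X(2,3)[OF that(2)] Y(2,3)[OF that(3)]
    by (cases "even a"; cases "even b"; cases "a \<le> b"; cases "S x \<le> S y";
      cases "even (S x)"; cases "even (S y)") (auto simp: max_def)
  have 3: "max (S x) (S y) < max a b"
    if "even (max a b)" "x \<in> X" "y \<in> Y" "odd (max (S x) (S y))" for x y
    using that X(2,3)[OF that(2)] Y(2,3)[OF that(3)]
    by (cases "even a"; cases "even b"; cases "a \<le> b"; cases "S x \<le> S y") (auto simp: max_def)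
  show ?thesis
    unfolding is_suspense_def using 1 2 3 \<open>0 < max a b\<close> by auto
qed

lemma misere_suspense_plus: "misere_suspense (G + H) = max (misere_suspense G) (misere_suspense H)"
proof (induction "sum_mset (G + H)" arbitrary: G H rule: less_induct)
  case less
  let ?S = misere_suspense
  show ?case
  proof (cases "\<forall>k\<in>#G + H. k = 0")
    case True
    then show ?thesis
      by (simp add: misere_suspense_terminal)
  next
    case False
    then have opts: "options (G + H) = {A + B | A B. A \<in> moves G \<and> B \<in> moves H}"
      by (simp add: moves_plus flip: moves_nonterminal)
    \<comment> \<open>The induction runs on the total number of vertices because a terminal summand
      does not shrink, whereas the whole sum does.\<close>
    have "?S (A + B) = max (?S A) (?S B)" if "A \<in> moves G" "B \<in> moves H" for A B
      by (rule less) (use that opts options_sum_less in blast)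
    then have "?S ` options (G + H) = {max (?S A) (?S B) | A B. A \<in> moves G \<and> B \<in> moves H}"
      unfolding opts by force
    moreover have "0 < max (?S G) (?S H)"
      using False misere_suspense_moves(4) by fastforce
    ultimately show ?thesis
      using is_suspense_max[where S = ?S, OF misere_suspense_moves(1-3) misere_suspense_moves(1-3)]
      by (intro misere_suspense_eqI) simp
  qed
qed

section \<open>Windows of option values for a single path\<close>

text \<open>By the maximum rule and monotonicity a split counts as its larger part. That part ranges
  from half of \<open>k - 3\<close>, rounded up, which is \<open>(k - 2) div 2\<close>, to
  \<open>k - 4\<close>; the unsplit results add \<open>k - 3\<close> and
  \<open>k - 2\<close>.\<close>

lemma misere_suspense_path_image:
  assumes mono: "mono_on {..<k} (\<lambda>j. misere_suspense {#j#})" and "0 < k"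
  shows "misere_suspense ` options {#k#} = (\<lambda>j. misere_suspense {#j#}) ` {(k - 2) div 2..k - 2}"
proof -
  let ?f = "\<lambda>j. misere_suspense {#j#}"
  have pair: "misere_suspense {#i, j#} = ?f j" if "i \<le> j" "j < k" for i j
  proof -
    have "misere_suspense {#i, j#} = max (?f i) (?f j)"
      using misere_suspense_plus[of "{#j#}" "{#i#}"] by (simp add: max.commute)
    also have "\<dots> = ?f j"
      using that by (intro max_absorb2 mono_onD[OF mono]) auto
    finally show ?thesis .
  qed
  \<comment> \<open>Truncated subtraction gives the window \<open>{0..0}\<close> for
    \<open>k = 1\<close> and \<open>k = 2\<close>; for \<open>k = 3\<close> it is
    \<open>{0..1}\<close>.\<close>
  consider "k = 1 \<or> k = 2" | "k = 3" | "4 \<le> k"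
    using \<open>0 < k\<close> by linarith
  then show ?thesis
  proof cases
    case 3
    let ?P = "{{#i, j#} | i j. 1 \<le> i \<and> i \<le> j \<and> i + j = k - 3}"
    have "misere_suspense ` ?P = ?f ` {(k - 2) div 2..k - 4}"
    proof (intro equalityI subsetI)
      fix v assume "v \<in> misere_suspense ` ?P"
      then obtain i j where "v = misere_suspense {#i, j#}" "1 \<le> i" "i \<le> j" "i + j = k - 3"
        by blast
      then show "v \<in> ?f ` {(k - 2) div 2..k - 4}"
        by (intro image_eqI[of _ _ j]) (auto simp: pair)
    next
      fix v assume "v \<in> ?f ` {(k - 2) div 2..k - 4}"
      then obtain j where j: "v = ?f j" "(k - 2) div 2 \<le> j" "j \<le> k - 4"
        by auto
      show "v \<in> misere_suspense ` ?P"
      \<comment> \<open>\<open>P_4\<close> has no split, and the interval \<open>{1..0}\<close> is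
        empty accordingly.\<close>
      proof (cases "k = 4")
        case True
        with j show ?thesis by simp
      next
        case False
        with 3 j have "1 \<le> k - 3 - j" "k - 3 - j \<le> j" "k - 3 - j + j = k - 3" "j < k"
          by auto
        then have "{#k - 3 - j, j#} \<in> ?P" "v = misere_suspense {#k - 3 - j, j#}"
          using j(1) pair by (blast, simp)
        then show ?thesis
          by blast
      qed
    qed
    moreover have "{(k - 2) div 2..k - 2} = {k - 2, k - 3} \<union> {(k - 2) div 2..k - 4}"
      using 3 by auto
    ultimately show ?thesis
      using 3 by (simp add: options_singleton node_kayles_results_def image_Un)
  next
    case 2
    have "{0..1::nat} = {0, 1}"
      by auto
    with 2 show ?thesis
      by (simp add: options_singleton node_kayles_results_def)
  qed (auto simp: options_singleton node_kayles_results_def)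
qed

lemma misere_suspense_path_odd:
  assumes "mono_on {..<k} (\<lambda>j. misere_suspense {#j#})" "0 < k"
    and "\<And>j. j \<in> {(k - 2) div 2..k - 2} \<Longrightarrow> misere_suspense {#j#} = 2 * n"
  shows "misere_suspense {#k#} = 2 * n + 1"
proof (rule misere_suspense_eqI)
  have "misere_suspense ` options {#k#} = {2 * n}"
    unfolding misere_suspense_path_image[OF assms(1,2)]
    using assms(3) by (force intro: image_eqI[of _ _ "k - 2"])
  then show "is_suspense (misere_suspense ` options {#k#}) (2 * n + 1)"
    by (simp add: is_suspense_def)
qed

text \<open>The value \<open>2 * n + 2\<close> may also occur in the window: being even, it does not
  compete with the largest odd value \<open>2 * n + 1\<close>. So the lemma applies repeatedly along
  an even block.\<close>

lemma misere_suspense_path_even: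
  assumes "mono_on {..<k} (\<lambda>j. misere_suspense {#j#})" "0 < k"
    and "\<And>j. j < k \<Longrightarrow> misere_suspense {#j#} \<le> 2 * n + 2"
    and "j \<in> {(k - 2) div 2..k - 2}" "misere_suspense {#j#} = 2 * n + 1"
  shows "misere_suspense {#k#} = 2 * n + 2"
proof (rule misere_suspense_eqI)
  have "v < 2 * n + 2" if "v \<in> misere_suspense ` options {#k#}" "odd v" for v
  proof -
    have "v \<le> 2 * n + 2"
      using that(1) assms(2,3) unfolding misere_suspense_path_image[OF assms(1,2)] by auto
    moreover have "v \<noteq> 2 * n + 2"
      using that(2) by auto
    ultimately show ?thesis
      by simp
  qed
  moreover have "2 * n + 1 \<in> misere_suspense ` options {#k#}"
    unfolding misere_suspense_path_image[OF assms(1,2)]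
    by (rule image_eqI[OF _ assms(4)]) (simp add: assms(5))
  ultimately show "is_suspense (misere_suspense ` options {#k#}) (2 * n + 2)"
    by (auto simp: is_suspense_def)
qed

lemma mono_on_lessThan_Suc:
  fixes f :: "nat \<Rightarrow> 'a::preorder"
  assumes "mono_on {..<k} f" "\<And>j. j < k \<Longrightarrow> f j \<le> f k"
  shows "mono_on {..<Suc k} f"
  using assms by (auto simp: monotone_on_def less_Suc_eq)

section \<open>Induction over the blocks of constant value\<close>

text \<open>The invariant at the start \<open>a\<close> of an odd block. The constant stretch runs
  up to \<open>a - 1\<close>, one beyond the window of \<open>a\<close>, so as to cover the window
  of \<open>a + 1\<close> too.\<close>

definition plateau_before :: "nat \<Rightarrow> nat \<Rightarrow> bool" where
  "plateau_before a n \<longleftrightarrow> mono_on {..<a} (\<lambda>j. misere_suspense {#j#}) \<and>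
    (\<forall>j<a. misere_suspense {#j#} \<le> 2 * n) \<and>
    (\<forall>j. (a - 2) div 2 \<le> j \<and> j < a \<longrightarrow> misere_suspense {#j#} = 2 * n)"

lemma plateau_before_step:
  assumes "plateau_before a n" "0 < a" "a = 1 \<or> even a"
  shows "misere_suspense {#a#} = 2 * n + 1" "misere_suspense {#a + 1#} = 2 * n + 1"
    and "\<And>k. a + 2 \<le> k \<Longrightarrow> k < 2 * a + 6 \<Longrightarrow> misere_suspense {#k#} = 2 * n + 2"
    and "plateau_before (2 * a + 6) (Suc n)"
proof -
  let ?f = "\<lambda>j. misere_suspense {#j#}"
  have mono: "mono_on {..<a} ?f" and le: "\<And>j. j < a \<Longrightarrow> ?f j \<le> 2 * n"
    and eq: "\<And>j. (a - 2) div 2 \<le> j \<Longrightarrow> j < a \<Longrightarrow> ?f j = 2 * n"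
    using assms(1) by (auto simp: plateau_before_def)
  show f0: "?f a = 2 * n + 1"
    by (rule misere_suspense_path_odd) (use mono assms(2) eq in auto)
  have mono1: "mono_on {..<a + 1} ?f"
    using mono_on_lessThan_Suc[OF mono] le f0 by (simp add: le_SucI)
  show f1: "?f (a + 1) = 2 * n + 1"
  proof (rule misere_suspense_path_odd[OF mono1])
    fix j assume "j \<in> {(a + 1 - 2) div 2..a + 1 - 2}"
    \<comment> \<open>Rounding for even \<open>a\<close>, and truncation for \<open>a = 1\<close>,
      let the windows of \<open>a\<close> and \<open>a + 1\<close> start at the same place.\<close>
    moreover have "(a - 2) div 2 = (a + 1 - 2) div 2"
      using assms(3) by presburger
    ultimately show "?f j = 2 * n"
      using assms(2) by (intro eq) auto
  qed simp
  have mono2: "mono_on {..<a + 2} ?f"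
  proof -
    have "?f j \<le> ?f (a + 1)" if "j < a + 1" for j
      using le[of j] f0 f1 that by (cases "j = a") auto
    then show ?thesis
      using mono_on_lessThan_Suc[OF mono1] by simp
  qed
  have le2: "?f j \<le> 2 * n + 1" if "j < a + 2" for j
    using that le[of j] f0 f1 by (cases "j < a"; cases "j = a"; cases "j = a + 1") auto
  \<comment> \<open>Values, bound and monotonicity are proved together, because the window of each
    new path is usable only once monotonicity is known below it.\<close>
  have main: "mono_on {..<a + 2 + d} ?f \<and> (\<forall>j<a + 2 + d. ?f j \<le> 2 * n + 2) \<and>
      (\<forall>j. a + 2 \<le> j \<and> j < a + 2 + d \<longrightarrow> ?f j = 2 * n + 2)" if "d \<le> a + 4" for d
    using that
  proof (induction d)
    case 0
    show ?case
      using mono2 le2 by (auto simp: le_SucI)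
  next
    case (Suc d)
    let ?k = "a + 2 + d"
    have IH: "mono_on {..<?k} ?f" "\<And>j. j < ?k \<Longrightarrow> ?f j \<le> 2 * n + 2"
        "\<And>j. a + 2 \<le> j \<Longrightarrow> j < ?k \<Longrightarrow> ?f j = 2 * n + 2"
      using Suc by auto
    have "?f ?k = 2 * n + 2"
    \<comment> \<open>The window of \<open>a + 2\<close> ends at \<open>a\<close>, so
      \<open>a\<close> is the odd witness there. Later windows reach \<open>a + 1\<close>, and as
      \<open>d \<le> a + 3\<close> here they start no later than
      \<open>(2 * a + 3) div 2 = a + 1\<close>.\<close>
    proof (cases "d = 0")
      case True
      then show ?thesis
        by (intro misere_suspense_path_even[of _ _ a]) (use IH f0 in auto)
    next
      case False
      then show ?thesis
        using Suc.prems by (intro misere_suspense_path_even[of _ _ "a + 1"]) (use IH f1 in auto)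
    qed
    moreover have "mono_on {..<Suc ?k} ?f"
      by (rule mono_on_lessThan_Suc) (use IH calculation in auto)
    ultimately show ?case
      using IH by (auto simp: less_Suc_eq)
  qed
  have "a + 2 + (a + 4) = 2 * a + 6"
    by simp
  with main[of "a + 4"] have all: "mono_on {..<2 * a + 6} ?f" "\<And>j. j < 2 * a + 6 \<Longrightarrow> ?f j \<le> 2 * n + 2"
      "\<And>j. a + 2 \<le> j \<Longrightarrow> j < 2 * a + 6 \<Longrightarrow> ?f j = 2 * n + 2"
    by (metis order_refl)+
  show "?f k = 2 * n + 2" if "a + 2 \<le> k" "k < 2 * a + 6" for k
    using all(3) that .
  have "(2 * a + 6 - 2) div 2 = a + 2"
    by simp
  then show "plateau_before (2 * a + 6) (Suc n)"
    unfolding plateau_before_def using all by simp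
qed

text \<open>The step \<open>a\<close> to \<open>2 * a + 6\<close> doubles \<open>a + 6\<close>;
  starting from \<open>a = 1\<close>, where only the empty path precedes, \<open>a + 6\<close> is
  \<open>7 * 2 ^ n\<close>.\<close>

lemma plateau_before_power: "plateau_before (7 * 2 ^ n - 6) n"
proof (induction n)
  case 0
  have "{..<Suc 0} = {0}"
    by auto
  then show ?case
    by (simp add: plateau_before_def misere_suspense_terminal monotone_on_def)
next
  case (Suc n)
  have "1 \<le> (2::nat) ^ n"
    by simp
  then have "2 * (7 * 2 ^ n - 6) + 6 = 7 * 2 ^ Suc n - (6::nat)" "0 < 7 * 2 ^ n - (6::nat)"
    unfolding power_Suc by linarith+
  moreover have "7 * 2 ^ n - 6 = (1::nat) \<or> even (7 * 2 ^ n - (6::nat))"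
    by (cases n) auto
  ultimately show ?case
    using plateau_before_step(4)[OF Suc] by simp
qed

theorem theorem5:
  shows "mono (\<lambda>n::nat. misere_suspense {#n#}) \<and>
    (\<forall>n::nat.
      misere_suspense {#7 * 2 ^ n - 6#} = 2 * n + 1 \<and>
      misere_suspense {#7 * 2 ^ n - 5#} = 2 * n + 1 \<and>
      (\<forall>k::nat. 7 * 2 ^ n - 4 \<le> k \<and> k \<le> 7 * 2 ^ (n + 1) - 7 \<longrightarrow>
        misere_suspense {#k#} = 2 * n + 2))"
proof (intro conjI allI impI)
  show "mono (\<lambda>n::nat. misere_suspense {#n#})"
  proof (rule monoI)
    fix x y :: nat assume "x \<le> y"
    \<comment> \<open>Monotonicity is known only on initial segments; taking \<open>n = y\<close>
      gives one that contains both \<open>x\<close> and \<open>y\<close>.\<close>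
    moreover have "y < 7 * 2 ^ y - 6"
      using less_exp[of y] by linarith
    moreover have "mono_on {..<7 * 2 ^ y - 6} (\<lambda>n::nat. misere_suspense {#n#})"
      using plateau_before_power[of y] by (simp add: plateau_before_def)
    ultimately show "misere_suspense {#x#} \<le> misere_suspense {#y#}"
      by (auto elim!: mono_onD)
  qed
next
  fix n :: nat
  \<comment> \<open>This ensures that none of the subtractions from \<open>7 * 2 ^ n\<close> below
    truncates.\<close>
  have "1 \<le> (2::nat) ^ n"
    by simp
  then have pos: "0 < 7 * 2 ^ n - (6::nat)" and next1: "7 * 2 ^ n - 6 + 1 = 7 * 2 ^ n - (5::nat)"
    and next2: "7 * 2 ^ n - 6 + 2 = 7 * 2 ^ n - (4::nat)"
    and double: "2 * (7 * 2 ^ n - 6) + 6 = 7 * 2 ^ (n + 1) - (6::nat)"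
    unfolding Suc_eq_plus1[symmetric] power_Suc by linarith+
  have "7 * 2 ^ n - 6 = (1::nat) \<or> even (7 * 2 ^ n - (6::nat))"
    by (cases n) auto
  note step = plateau_before_step[OF plateau_before_power pos this, unfolded next1 next2 double]
  show "misere_suspense {#7 * 2 ^ n - 6#} = 2 * n + 1"
    and "misere_suspense {#7 * 2 ^ n - 5#} = 2 * n + 1"
    using step(1,2) .
  fix k :: nat
  assume "7 * 2 ^ n - 4 \<le> k \<and> k \<le> 7 * 2 ^ (n + 1) - 7"
  moreover have "7 * 2 ^ (n + 1) - 7 < 7 * 2 ^ (n + 1) - (6::nat)"
    using pos by simp
  ultimately show "misere_suspense {#k#} = 2 * n + 2"
    using step(3)[of k] by linarith
qed

end
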